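(* Let $\mathcal{C}\subset\mathbb{R}^3$ be a fixed homogeneous circle with constant density $\lambda>0$ and let $V(\mathbf{r})=-\int_{\mathcal{C}}\frac{\lambda\,du}{\|\mathbf{r}-u\|}$, $\mathbf{r}\in\mathbb{R}^3\setminus\mathcal{C}$, be its gravitational potential. Then all singularities of solutions of $\ddot{\mathbf{r}}=-\nabla V(\mathbf{r})$ are collision singularities. That is, if $\mathbf{r}(t)$ is a solution with maximal interval of definition $(a,b)$ and $b<+\infty$ (respectively $a>-\infty$), then there is a point $\mathbf{r}^*\in\mathcal{C}$ such that $\mathbf{r}(t)\to\mathbf{r}^*$ as $t\to b^-$ (respectively as $t\to a^+$).
   Context: The circle $\mathcal{C}$ is a round (planar) circle in Euclidean three-space, $du$ is arc length on $\mathcal{C}$, and solutions take values in $\mathbb{R}^3\setminus\mathcal{C}$. A solution $\mathbf{r}(t)$ with maximal interval $(a,b)$ has a singularity at $b$ if $b<+\infty$ (at $a$ if $a>-\infty$). A singularity at $c\in\{a,b\}$ is a collision singularity if there exists $\mathbf{r}^*\in\mathcal{C}$ with $\mathbf{r}(t)\to\mathbf{r}^*$ as $t\to c$; otherwise it is a singularity without collision. *)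

theory Defs
  imports "HOL-Analysis.Analysis"
begin

text \<open>
  A round circle in Euclidean three-space is given by its centre \<open>c\<close>, its radius \<open>R > 0\<close> and an
  orthonormal pair \<open>e1\<close>, \<open>e2\<close> spanning the direction of its plane.  The parameter \<open>s\<close> below is arc
  length (lemma \<open>circle_point_unit_speed\<close>), so the circle is traversed once on \<open>{0..2 * pi * R}\<close>.
\<close>

definition circle_point ::
    "real^3 \<Rightarrow> real \<Rightarrow> real^3 \<Rightarrow> real^3 \<Rightarrow> real \<Rightarrow> real^3" where
  "circle_point c R e1 e2 s = c + (R * cos (s / R)) *\<^sub>R e1 + (R * sin (s / R)) *\<^sub>R e2"

definition round_circle :: "real^3 \<Rightarrow> real \<Rightarrow> real^3 \<Rightarrow> real^3 \<Rightarrow> (real^3) set" where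
  "round_circle c R e1 e2 = circle_point c R e1 e2 ` {0..2 * pi * R}"

definition circle_potential ::
    "real^3 \<Rightarrow> real \<Rightarrow> real^3 \<Rightarrow> real^3 \<Rightarrow> real \<Rightarrow> real^3 \<Rightarrow> real" where
  "circle_potential c R e1 e2 lam x =
     - integral {0..2 * pi * R} (\<lambda>s. lam / norm (x - circle_point c R e1 e2 s))"

definition newton_solution_on ::
    "(real^3) set \<Rightarrow> (real^3 \<Rightarrow> real) \<Rightarrow> real set \<Rightarrow> (real \<Rightarrow> real^3) \<Rightarrow> bool" where
  "newton_solution_on C V I r \<longleftrightarrow>
     (\<forall>t\<in>I. r t \<notin> C) \<and>
     (\<exists>v. \<forall>t\<in>I. (r has_vector_derivative v t) (at t) \<and>
        (\<exists>g. GDERIV V (r t) :> g \<and> (v has_vector_derivative - g) (at t)))"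

text \<open>
  The end points are extended reals, and \<open>einterval a b\<close> is the set of real \<open>t\<close> with \<open>a < t < b\<close>.
  The values of \<open>r\<close> outside this interval are irrelevant.
\<close>

definition maximal_newton_solution ::
    "(real^3) set \<Rightarrow> (real^3 \<Rightarrow> real) \<Rightarrow> ereal \<Rightarrow> ereal \<Rightarrow> (real \<Rightarrow> real^3) \<Rightarrow> bool" where
  "maximal_newton_solution C V a b r \<longleftrightarrow>
     a < b \<and> newton_solution_on C V (einterval a b) r \<and>
     (\<forall>a' b' q. a' \<le> a \<and> b \<le> b' \<and> newton_solution_on C V (einterval a' b') q \<and>
        (\<forall>t\<in>einterval a b. q t = r t) \<longrightarrow> a' = a \<and> b' = b)"

lemma circle_point_unit_speed:
  assumes "R > 0" "norm e1 = 1" "norm e2 = 1" "e1 \<bullet> e2 = 0"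
  shows "\<exists>w. (circle_point c R e1 e2 has_vector_derivative w) (at s) \<and> norm w = 1"
proof (intro exI conjI)
  let ?w = "(- sin (s / R)) *\<^sub>R e1 + cos (s / R) *\<^sub>R e2"
  show "(circle_point c R e1 e2 has_vector_derivative ?w) (at s)"
    unfolding circle_point_def[abs_def]
    using assms(1) by (auto intro!: derivative_eq_intros simp: has_vector_derivative_def algebra_simps)
  have "e1 \<bullet> e1 = 1" "e2 \<bullet> e2 = 1" using assms by (simp_all add: norm_eq_1)
  then have "?w \<bullet> ?w = 1"
    using assms(4) sin_cos_squared_add[of "s / R", unfolded power2_eq_square] inner_commute[of e2 e1]
    by (simp add: inner_add_left inner_add_right inner_diff_left inner_diff_right)
  then show "norm ?w = 1" by (simp only: norm_eq_1)
qed

lemma round_circle_eq: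
  assumes "R > 0" "norm e1 = 1" "norm e2 = 1" "e1 \<bullet> e2 = 0"
  shows "round_circle c R e1 e2 = {u. u - c \<in> span {e1, e2} \<and> norm (u - c) = R}"
proof -
  have e: "e1 \<bullet> e1 = 1" "e2 \<bullet> e2 = 1" using assms by (simp_all add: norm_eq_1)
  have nrm: "(norm (x *\<^sub>R e1 + y *\<^sub>R e2))\<^sup>2 = x\<^sup>2 + y\<^sup>2" for x y
    using e assms(4) inner_commute[of e2 e1]
    unfolding power2_norm_eq_inner
    by (simp add: inner_add_left inner_add_right power2_eq_square)
  show ?thesis
  proof (intro equalityI subsetI)
    fix u assume "u \<in> round_circle c R e1 e2"
    then obtain s where u: "u - c = (R * cos (s / R)) *\<^sub>R e1 + (R * sin (s / R)) *\<^sub>R e2"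
      by (auto simp: round_circle_def circle_point_def)
    have "(norm (u - c))\<^sup>2 = R\<^sup>2 * ((cos (s / R))\<^sup>2 + (sin (s / R))\<^sup>2)"
      unfolding u nrm by (simp only: power_mult_distrib distrib_left)
    then have "(norm (u - c))\<^sup>2 = R\<^sup>2" by simp
    then have "norm (u - c) = R" using assms(1) by (simp add: power2_eq_iff_nonneg)
    moreover have "u - c \<in> span {e1, e2}"
      unfolding u by (intro span_add span_scale span_base) auto
    ultimately show "u \<in> {u. u - c \<in> span {e1, e2} \<and> norm (u - c) = R}" by simp
  next
    fix u assume "u \<in> {u. u - c \<in> span {e1, e2} \<and> norm (u - c) = R}"
    then have sp: "u - c \<in> span {e1, e2}" and n: "norm (u - c) = R" by auto
    from sp obtain x where "u - c - x *\<^sub>R e1 \<in> span {e2}" by (auto simp: span_insert)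
    then obtain y where "u - c - x *\<^sub>R e1 = y *\<^sub>R e2" by (auto simp: span_singleton)
    then have u: "u - c = x *\<^sub>R e1 + y *\<^sub>R e2" by (simp add: algebra_simps)
    have "x\<^sup>2 + y\<^sup>2 = R\<^sup>2" using n nrm[of x y] u by simp
    then have "(x / R)\<^sup>2 + (y / R)\<^sup>2 = 1"
      using assms(1) by (simp add: power_divide add_divide_distrib[symmetric])
    then obtain t where t: "0 \<le> t" "t < 2 * pi" "x / R = cos t" "y / R = sin t"
      using sincos_total_2pi by metis
    have "u = circle_point c R e1 e2 (t * R)"
      using u t assms(1) by (simp add: circle_point_def field_simps)
    moreover have "t * R \<in> {0..2 * pi * R}" using t assms(1) by (simp add: mult_right_mono)
    ultimately show "u \<in> round_circle c R e1 e2" unfolding round_circle_def by blast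
  qed
qed

end

theory Submission imports Defs begin

text \<open>
  Let \<open>r\<close> be a solution that ends at a finite time \<open>b\<close>; the other end follows by reversing time.

  The solution approaches the circle.  The energy \<open>(norm (r'))\<^sup>2 / 2 + V r\<close> is constant and \<open>V\<close> is
  bounded below away from the circle, so there the speed is bounded.  If the distance to the circle
  did not tend to zero, then it would be bounded below near \<open>b\<close> (lemma \<open>stays_off_circle\<close>), as the
  particle cannot cross a gap of fixed width in arbitrarily short time.  Then \<open>r'\<close> and \<open>r''\<close> are
  bounded, position and velocity converge as \<open>t\<close> tends to \<open>b\<close>, and the Picard-Lindeloef theorem
  continues the solution beyond \<open>b\<close> (lemma \<open>continuation_off_circle\<close>), contrary to maximality.

  It approaches a single point of the circle.  By rotational symmetry the angular momentum
  \<open>J = \<rho>\<^sup>2 * \<theta>'\<close> about the axis of the circle is conserved (lemmas \<open>gradV_torque_zero\<close> and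
  \<open>angular_momentum_conserved\<close>).  Near the circle \<open>\<rho>\<close> is close to \<open>R > 0\<close>, so \<open>\<theta>'\<close> is bounded and
  \<open>\<theta>\<close> converges in finite time, while \<open>\<rho>\<close> tends to \<open>R\<close> and the height over the plane of the circle
  to zero (lemma \<open>collision_if_distance_tendsto_zero\<close>).
\<close>

section \<open>Continuation of solutions of ordinary differential equations\<close>

text \<open>
  The Picard operator is a contraction of the complete space of bounded continuous functions once
  the time step \<open>\<tau>\<close> satisfies \<open>L * \<tau> \<le> 1 / 2\<close>.  Clamping time to \<open>{b..b+\<tau>}\<close> makes the operator
  act on functions defined on the whole line.
\<close>

lemma picard_lindeloef_global_lipschitz:
  fixes G :: "'a::banach \<Rightarrow> 'a"
  assumes "L-lipschitz_on UNIV G"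
  obtains \<tau> y where "\<tau> > 0" "y b = z0"
    "\<And>t. t \<in> {b..b+\<tau>} \<Longrightarrow> (y has_vector_derivative G (y t)) (at t within {b..b+\<tau>})"
proof -
  have L: "L \<ge> 0" using assms by (rule lipschitz_on_nonneg)
  have contG: "continuous_on UNIV G" using assms by (rule lipschitz_on_continuous_on)
  define \<tau> where "\<tau> = 1 / (2 * (L + 1))"
  have \<tau>: "\<tau> > 0" "L * \<tau> \<le> 1/2" using L by (auto simp: \<tau>_def field_simps)
  let ?I = "cbox b (b + \<tau>)"
  have cGy: "continuous_on S (\<lambda>s. G (apply_bcontfun y s))" for y :: "real \<Rightarrow>\<^sub>C 'a" and S
    by (rule continuous_on_compose2[OF contG]) auto
  have intG: "(\<lambda>s. G (apply_bcontfun y s)) integrable_on {b..t}" for y :: "real \<Rightarrow>\<^sub>C 'a" and t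
    by (rule integrable_continuous_real[OF cGy])
  have "\<exists>Ty :: real \<Rightarrow>\<^sub>C 'a. \<forall>t. Ty t = z0 + integral {b..clamp b (b + \<tau>) t} (\<lambda>s. G (y s))"
    for y :: "real \<Rightarrow>\<^sub>C 'a"
  proof -
    have "continuous_on ?I (\<lambda>t. z0 + integral {b..t} (\<lambda>s. G (y s)))"
      using indefinite_integral_continuous_1[OF intG] by (auto intro!: continuous_intros)
    from continuous_on_cbox_bcontfunE[OF this] show ?thesis by metis
  qed
  then obtain T :: "(real \<Rightarrow>\<^sub>C 'a) \<Rightarrow> (real \<Rightarrow>\<^sub>C 'a)"
    where T: "\<And>y t. T y t = z0 + integral {b..clamp b (b + \<tau>) t} (\<lambda>s. G (y s))"
    by metis
  have "dist (T x) (T y) \<le> 1/2 * dist x y" for x y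
  proof (rule dist_bound)
    fix t
    define t' where "t' = clamp b (b + \<tau>) t"
    have t': "b \<le> t'" "t' - b \<le> \<tau>"
      using clamp_in_interval[of b "b + \<tau>" t] \<tau> by (auto simp: t'_def)
    have "norm (integral {b..t'} (\<lambda>s. G (x s) - G (y s))) \<le> (L * dist x y) * (t' - b)"
    proof (rule integral_bound[OF t'(1)])
      show "continuous_on {b..t'} (\<lambda>s. G (x s) - G (y s))"
        by (intro continuous_intros cGy)
      fix s
      have "norm (G (x s) - G (y s)) \<le> L * dist (x s) (y s)"
        using lipschitz_onD[OF assms, of "x s" "y s"] by (simp add: dist_norm)
      also have "\<dots> \<le> L * dist x y" using L by (intro mult_left_mono dist_bounded)
      finally show "norm (G (x s) - G (y s)) \<le> L * dist x y" .
    qed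
    also have "\<dots> \<le> (L * dist x y) * \<tau>"
      using L t' by (intro mult_left_mono) auto
    also have "\<dots> = (L * \<tau>) * dist x y" by simp
    also have "\<dots> \<le> 1/2 * dist x y" using \<tau> by (intro mult_right_mono) auto
    finally show "dist (T x t) (T y t) \<le> 1/2 * dist x y"
      by (simp add: T dist_norm t'_def integral_diff[OF intG intG])
  qed
  with banach_fix_type[of "1/2" T] obtain y where y: "T y = y" by auto
  have y': "y t = z0 + integral {b..t} (\<lambda>s. G (y s))" if "t \<in> {b..b+\<tau>}" for t
    using T[of y t] y that by simp
  show ?thesis
  proof
    show "\<tau> > 0" by fact
    show "y b = z0" using y'[of b] \<tau> by simp
    fix t assume t: "t \<in> {b..b+\<tau>}"
    have "((\<lambda>t. z0 + integral {b..t} (\<lambda>s. G (y s))) has_vector_derivative 0 + G (y t))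
        (at t within {b..b+\<tau>})"
      by (intro has_vector_derivative_add has_vector_derivative_const
          integral_has_vector_derivative cGy t)
    then have "((\<lambda>t. z0 + integral {b..t} (\<lambda>s. G (y s))) has_vector_derivative G (y t))
        (at t within {b..b+\<tau>})"
      by simp
    with t y' show "(y has_vector_derivative G (y t)) (at t within {b..b+\<tau>})"
      by (rule has_vector_derivative_transform)
  qed
qed

text \<open>
  A bounded derivative makes \<open>f\<close> Lipschitz, hence uniformly continuous, and such functions extend
  continuously to the closure.  This one principle yields all the limits at a singularity below: of
  position and velocity away from the circle, and of the direction in its plane close to it.
\<close>

lemma bounded_derivative_limit_at_left:
  fixes f :: "real \<Rightarrow> 'a::banach"
  assumes "t0 < b"
    and "\<And>t. t \<in> {t0<..<b} \<Longrightarrow> (f has_vector_derivative f' t) (at t)"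
    and "\<And>t. t \<in> {t0<..<b} \<Longrightarrow> norm (f' t) \<le> B"
  obtains l where "(f \<longlongrightarrow> l) (at_left b)"
proof -
  have "norm (f' ((t0 + b) / 2)) \<le> B" using assms(1) by (intro assms(3)) auto
  with norm_ge_zero have B: "0 \<le> B" by (rule order_trans)
  have "B-lipschitz_on {t0<..<b} f"
  proof (rule lipschitz_onI[OF _ B])
    fix s t assume st: "s \<in> {t0<..<b}" "t \<in> {t0<..<b}"
    have "norm (f s - f t) \<le> B * norm (s - t)"
    proof (rule differentiable_bound[OF _ _ _ st(1) st(2)])
      fix x assume x: "x \<in> {t0<..<b}"
      show "(f has_derivative (\<lambda>h. h *\<^sub>R f' x)) (at x within {t0<..<b})"
        using assms(2)[OF x] has_vector_derivative_at_within
        unfolding has_vector_derivative_def by (blast intro: has_derivative_at_withinI)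
      show "onorm (\<lambda>h. h *\<^sub>R f' x) \<le> B"
        using assms(3)[OF x] by (simp add: onorm_scaleR_left[OF bounded_linear_ident] onorm_id)
    qed auto
    then show "dist (f s) (f t) \<le> B * dist s t" by (simp add: dist_norm)
  qed
  then have "uniformly_continuous_on {t0<..<b} f"
    by (rule lipschitz_on_uniformly_continuous)
  moreover have "b \<in> closure {t0<..<b}" using assms(1) by simp
  ultimately obtain l where "(f \<longlongrightarrow> l) (at b within {t0<..<b})"
    by (rule uniformly_continuous_on_extension_at_closure)
  moreover have "at b within {t0<..<b} = at_left b"
    using assms(1) by (intro at_within_nhd[of b "{t0<..}"]) auto
  ultimately have "(f \<longlongrightarrow> l) (at_left b)" by simp
  then show ?thesis by (rule that)
qed

text \<open>
  The mean value inequality for \<open>f t - t *\<^sub>R m\<close>, whose derivative \<open>f' t - m\<close> is small near \<open>b\<close>, gives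
  a difference quotient estimate that survives the passage to the limit \<open>b\<close>.
\<close>

lemma left_derivative_from_limits:
  fixes f :: "real \<Rightarrow> 'a::real_normed_vector"
  assumes "t0 < b"
    and der: "\<And>t. t \<in> {t0<..<b} \<Longrightarrow> (f has_vector_derivative f' t) (at t)"
    and lim: "(f \<longlongrightarrow> l) (at_left b)" and lim': "(f' \<longlongrightarrow> m) (at_left b)"
  shows "((\<lambda>t. if t < b then f t else l) has_vector_derivative m) (at b within {..b})"
  unfolding has_vector_derivative_def has_derivative_within_alt
proof (intro conjI allI impI bounded_linear_scaleR_left)
  fix e :: real assume e: "e > 0"
  have "eventually (\<lambda>t. dist (f' t) m < e) (at_left b)" using lim' e by (rule tendstoD)
  then obtain t1 where t1: "t1 < b" "\<And>t. t1 < t \<Longrightarrow> t < b \<Longrightarrow> dist (f' t) m < e"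
    unfolding eventually_at_left_field by auto
  define t2 where "t2 = max t0 t1"
  have t2: "t2 < b" using t1 assms(1) by (simp add: t2_def)
  have bd: "norm (f s - f t - (s - t) *\<^sub>R m) \<le> e * norm (s - t)"
    if st: "s \<in> {t2<..<b}" "t \<in> {t2<..<b}" for s t
  proof -
    have "norm ((f s - s *\<^sub>R m) - (f t - t *\<^sub>R m)) \<le> e * norm (s - t)"
    proof (rule differentiable_bound[OF _ _ _ st(1) st(2)])
      fix x assume x: "x \<in> {t2<..<b}"
      then have "((\<lambda>t. f t - t *\<^sub>R m) has_vector_derivative f' x - m) (at x)"
        using der[of x] by (auto intro!: derivative_eq_intros simp: t2_def)
      then show "((\<lambda>t. f t - t *\<^sub>R m) has_derivative (\<lambda>h. h *\<^sub>R (f' x - m))) (at x within {t2<..<b})"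
        unfolding has_vector_derivative_def by (rule has_derivative_at_withinI)
      show "onorm (\<lambda>h. h *\<^sub>R (f' x - m)) \<le> e"
        using t1(2)[of x] x
        by (simp add: onorm_scaleR_left[OF bounded_linear_ident] onorm_id dist_norm t2_def)
    qed auto
    then show ?thesis by (simp add: algebra_simps)
  qed
  have bd2: "norm (f t - l - (t - b) *\<^sub>R m) \<le> e * norm (t - b)" if t: "t \<in> {t2<..<b}" for t
  proof (rule tendsto_le[OF trivial_limit_at_left_real])
    show "((\<lambda>s. norm (f t - f s - (t - s) *\<^sub>R m)) \<longlongrightarrow> norm (f t - l - (t - b) *\<^sub>R m)) (at_left b)"
      by (intro tendsto_intros lim)
    show "((\<lambda>s. e * norm (t - s)) \<longlongrightarrow> e * norm (t - b)) (at_left b)"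
      by (intro tendsto_intros)
    show "eventually (\<lambda>s. norm (f t - f s - (t - s) *\<^sub>R m) \<le> e * norm (t - s)) (at_left b)"
      unfolding eventually_at_left_field using t2 bd t by (intro exI[of _ t2]) auto
  qed
  show "\<exists>d>0. \<forall>y\<in>{..b}. norm (y - b) < d \<longrightarrow>
      norm ((if y < b then f y else l) - (if b < b then f b else l) - (y - b) *\<^sub>R m) \<le> e * norm (y - b)"
  proof (intro exI[of _ "b - t2"] conjI ballI impI)
    show "b - t2 > 0" using t2 by simp
    fix y assume "y \<in> {..b}" "norm (y - b) < b - t2"
    then show "norm ((if y < b then f y else l) - (if b < b then f b else l) - (y - b) *\<^sub>R m)
        \<le> e * norm (y - b)"
      using bd2[of y] by auto
  qed
qed

text \<open>
  A solution that converges, as \<open>t\<close> increases to \<open>b\<close>, to an interior point of a region where the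
  vector field is Lipschitz can be continued past \<open>b\<close>: a solution starting at the limit point is
  attached on the right, and the one-sided derivatives at \<open>b\<close> agree because the vector field is
  continuous there.
\<close>

lemma ode_continuation:
  fixes z :: "real \<Rightarrow> 'a::euclidean_space"
  assumes "t0 < b" and "\<delta> > 0" and lip: "L-lipschitz_on (cball z0 \<delta>) G"
    and der: "\<And>t. t \<in> {t0<..<b} \<Longrightarrow> (z has_vector_derivative G (z t)) (at t)"
    and lim: "(z \<longlongrightarrow> z0) (at_left b)"
  obtains \<tau> y where "\<tau> > 0" "\<And>t. t < b \<Longrightarrow> y t = z t"
    "\<And>t. t \<in> {b..<b+\<tau>} \<Longrightarrow> y t \<in> cball z0 \<delta>"
    "\<And>t. t \<in> {t0<..<b+\<tau>} \<Longrightarrow> (y has_vector_derivative G (y t)) (at t)"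
proof -
  let ?B = "cball z0 \<delta>" and ?P = "closest_point (cball z0 \<delta>)"
  have B: "convex ?B" "closed ?B" "?B \<noteq> {}" using assms(2) by auto
  have L: "L \<ge> 0" using lip by (rule lipschitz_on_nonneg)
  \<comment> \<open>Precomposing with the nearest-point projection onto the ball makes the field globally
     Lipschitz without changing it on the ball.\<close>
  have "L-lipschitz_on UNIV (\<lambda>z. G (?P z))"
  proof (rule lipschitz_onI[OF _ L])
    fix x y
    have "dist (G (?P x)) (G (?P y)) \<le> L * dist (?P x) (?P y)"
      by (intro lipschitz_onD[OF lip] closest_point_in_set B)
    also have "\<dots> \<le> L * dist x y" using L by (intro mult_left_mono closest_point_lipschitz B)
    finally show "dist (G (?P x)) (G (?P y)) \<le> L * dist x y" .
  qed
  from picard_lindeloef_global_lipschitz[OF this, of b z0]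
  obtain \<sigma> w where \<sigma>: "\<sigma> > 0" and wb: "w b = z0"
    and w: "\<And>t. t \<in> {b..b+\<sigma>} \<Longrightarrow> (w has_vector_derivative G (?P (w t))) (at t within {b..b+\<sigma>})"
    by blast
  have "continuous (at b within {b..b+\<sigma>}) w"
    using w[of b] \<sigma> by (intro has_vector_derivative_continuous) auto
  then obtain d where d: "d > 0" "\<And>t. t \<in> {b..b+\<sigma>} \<Longrightarrow> dist t b < d \<Longrightarrow> dist (w t) z0 < \<delta>"
    unfolding continuous_within_eps_delta using assms(2) wb by metis
  define \<tau> where "\<tau> = min d \<sigma>"
  have \<tau>: "\<tau> > 0" using d \<sigma> by (simp add: \<tau>_def)
  have wB: "w t \<in> ?B" if "t \<in> {b..<b+\<tau>}" for t
    using d(2)[of t] that by (fastforce simp: \<tau>_def dist_real_def dist_commute[of z0])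
  have w': "(w has_vector_derivative G (w t)) (at t within {b..b+\<sigma>})" if "t \<in> {b..<b+\<tau>}" for t
    using w[of t] closest_point_self[OF wB[OF that]] that by (auto simp: \<tau>_def)
  define y where "y t = (if t < b then z t else w t)" for t
  have "(y has_vector_derivative G (y t)) (at t)" if t: "t \<in> {t0<..<b+\<tau>}" for t
  proof -
    consider "t < b" | "t > b" | "t = b" by linarith
    then show ?thesis
    proof cases
      case 1
      then have "(z has_vector_derivative G (y t)) (at t)" using der[of t] t by (simp add: y_def)
      moreover have "eventually (\<lambda>s. s < b) (nhds t)"
        using 1 by (intro order_tendstoD(2)[OF filterlim_ident])
      ultimately show ?thesis
        by (subst has_vector_derivative_cong_ev[where g = z and x = t and S = UNIV])
           (auto simp: y_def 1 elim!: eventually_mono)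
    next
      case 2
      have "(w has_vector_derivative G (w t)) (at t within {b<..<b+\<sigma>})"
        by (rule has_vector_derivative_within_subset[OF w']) (use t 2 in auto)
      then have "(w has_vector_derivative G (y t)) (at t)"
        using 2 t at_within_open[of t "{b<..<b+\<sigma>}"] by (auto simp: y_def \<tau>_def)
      moreover have "eventually (\<lambda>s. s > b) (nhds t)"
        using 2 by (intro order_tendstoD(1)[OF filterlim_ident])
      ultimately show ?thesis
        by (subst has_vector_derivative_cong_ev[where g = w and x = t and S = UNIV])
           (use 2 in \<open>auto simp: y_def elim!: eventually_mono\<close>)
    next
      case 3
      have "continuous (at z0) G"
        by (rule continuous_on_interior[OF lipschitz_on_continuous_on[OF lip]]) (use assms(2) in simp)
      then have "((\<lambda>t. G (z t)) \<longlongrightarrow> G z0) (at_left b)"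
        using lim by (rule isCont_tendsto_compose)
      from left_derivative_from_limits[OF assms(1) der lim this]
      have "((\<lambda>t. if t < b then z t else z0) has_vector_derivative G z0) (at b within {..b})" .
      then have "(y has_vector_derivative G z0) (at b within {..b})"
        by (rule has_vector_derivative_transform[rotated 2]) (auto simp: y_def wb)
      moreover have "(y has_vector_derivative G z0) (at b within {b..b+\<sigma>})"
        using w'[of b] \<tau> wb
        by (auto intro: has_vector_derivative_transform[rotated 2] simp: y_def \<sigma> less_imp_le)
      ultimately have "(y has_vector_derivative G z0) (at b within ({..b} \<union> {b..b+\<sigma>}))"
        unfolding has_vector_derivative_def has_derivative_within by (auto intro: Lim_Un)
      then have "(y has_vector_derivative G z0) (at b)"
        using has_vector_derivative_within_subset[of y _ b _ "{..<b+\<sigma>}"] \<sigma>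
          at_within_open[of b "{..<b+\<sigma>}"]
        by force
      then show ?thesis using 3 wb by (simp add: y_def)
    qed
  qed
  then show ?thesis using \<tau> wB by (intro that[of \<tau> y]) (auto simp: y_def)
qed

section \<open>The potential of a homogeneous circle and its gradient\<close>

text \<open>
  With \<open>p = norm w\<close> and \<open>q = norm z\<close>, the difference splits into
  \<open>(1 / p ^ 3) *\<^sub>R (w - z)\<close> and \<open>(1 / p ^ 3 - 1 / q ^ 3) *\<^sub>R z\<close>; the first contributes one summand
  \<open>1 / d ^ 3\<close> and the factorisation of \<open>q ^ 3 - p ^ 3\<close> the other three.
\<close>

lemma inverse_square_field_lipschitz:
  fixes w z :: "'a::real_normed_vector"
  assumes "d > 0" "d \<le> norm w" "d \<le> norm z"
  shows "norm ((1 / norm w ^ 3) *\<^sub>R w - (1 / norm z ^ 3) *\<^sub>R z) \<le> 4 / d ^ 3 * norm (w - z)"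
proof -
  define p q D where "p = norm w" and "q = norm z" and "D = norm (w - z)"
  have pq: "0 < p" "0 < q" "d \<le> p" "d \<le> q" "\<bar>p - q\<bar> \<le> D" "0 \<le> D"
    using assms norm_triangle_ineq3[of w z] by (auto simp: p_def q_def D_def)
  have d3: "1 / x \<le> 1 / d ^ 3" if "d ^ 3 \<le> x" for x
    using that assms(1) by (intro divide_left_mono mult_pos_pos) (auto intro: less_le_trans[OF _ that])
  have "(1 / p ^ 3) *\<^sub>R w - (1 / q ^ 3) *\<^sub>R z
      = (1 / p ^ 3) *\<^sub>R (w - z) + (1 / p ^ 3 - 1 / q ^ 3) *\<^sub>R z"
    by (simp add: algebra_simps)
  then have "norm ((1 / p ^ 3) *\<^sub>R w - (1 / q ^ 3) *\<^sub>R z)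
      \<le> 1 / p ^ 3 * D + \<bar>1 / p ^ 3 - 1 / q ^ 3\<bar> * q"
    using norm_triangle_ineq[of "(1 / p ^ 3) *\<^sub>R (w - z)" "(1 / p ^ 3 - 1 / q ^ 3) *\<^sub>R z"] pq
    by (simp add: D_def q_def)
  also have "\<bar>1 / p ^ 3 - 1 / q ^ 3\<bar> * q = \<bar>p - q\<bar> * (1 / (p * q ^ 2) + 1 / (p ^ 2 * q) + 1 / p ^ 3)"
  proof -
    have "(1 / p ^ 3 - 1 / q ^ 3) * q = - (p - q) * (1 / (p * q ^ 2) + 1 / (p ^ 2 * q) + 1 / p ^ 3)"
      using pq by (simp add: field_simps power2_eq_square power3_eq_cube)
    then have "\<bar>(1 / p ^ 3 - 1 / q ^ 3) * q\<bar> = \<bar>- (p - q) * (1 / (p * q ^ 2) + 1 / (p ^ 2 * q) + 1 / p ^ 3)\<bar>"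
      by simp
    then show ?thesis using pq by (simp add: abs_mult abs_minus_commute)
  qed
  also have "\<dots> \<le> D * (1 / d ^ 3 + 1 / d ^ 3 + 1 / d ^ 3)"
  proof (intro mult_mono add_mono d3)
    show "d ^ 3 \<le> p * q ^ 2"
    proof -
      have "d * d ^ 2 \<le> p * q ^ 2" using pq assms(1) by (intro mult_mono power_mono) auto
      then show ?thesis by (simp add: power3_eq_cube power2_eq_square)
    qed
    show "d ^ 3 \<le> p ^ 2 * q"
    proof -
      have "d ^ 2 * d \<le> p ^ 2 * q" using pq assms(1) by (intro mult_mono power_mono) auto
      then show ?thesis by (simp add: power3_eq_cube power2_eq_square)
    qed
    show "d ^ 3 \<le> p ^ 3" using pq assms(1) by (simp add: power_mono)
  qed (use pq in auto)
  also have "1 / p ^ 3 * D \<le> 1 / d ^ 3 * D"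
    using pq assms(1) by (intro mult_right_mono d3 power_mono) auto
  finally show ?thesis by (simp add: p_def q_def D_def field_simps)
qed

lemma inner_sgn_over_square:
  "a * (h \<bullet> sgn w) / (norm w)\<^sup>2 = a / norm w ^ 3 * (h \<bullet> w)"
  by (cases "w = 0") (simp_all add: sgn_div_norm field_simps power2_eq_square power3_eq_cube)

locale homogeneous_circle =
  fixes c e1 e2 :: "real^3" and R lam :: real
  assumes R_pos: "R > 0" and lam_pos: "lam > 0"
    and norm_e1: "norm e1 = 1" and norm_e2: "norm e2 = 1" and orth: "e1 \<bullet> e2 = 0"
begin

abbreviation "u \<equiv> circle_point c R e1 e2"
abbreviation "\<C> \<equiv> round_circle c R e1 e2"
abbreviation "V \<equiv> circle_potential c R e1 e2 lam"

lemma inner_e [simp]: "e1 \<bullet> e1 = 1" "e2 \<bullet> e2 = 1" "e1 \<bullet> e2 = 0" "e2 \<bullet> e1 = 0"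
  using norm_e1 norm_e2 orth by (simp_all add: norm_eq_1 inner_commute)

text \<open>
  This is the integral of the gradients of the point potentials \<open>- lam / norm (x - u s)\<close>; lemma
  \<open>GDERIV_V\<close> justifies the name.
\<close>

definition gradV :: "real^3 \<Rightarrow> real^3" where
  "gradV x = integral {0..2 * pi * R} (\<lambda>s. (lam / norm (x - u s) ^ 3) *\<^sub>R (x - u s))"

lemma continuous_on_circle_point: "continuous_on S u"
  unfolding circle_point_def[abs_def] using R_pos by (auto intro!: continuous_intros)

lemma compact_circle: "compact \<C>"
  unfolding round_circle_def
  by (intro compact_continuous_image continuous_on_circle_point) simp

lemma circle_nonempty: "\<C> \<noteq> {}"
  using R_pos by (simp add: round_circle_def)

lemma notin_circle_iff: "x \<notin> \<C> \<longleftrightarrow> infdist x \<C> > 0"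
  using in_closed_iff_infdist_zero[OF compact_imp_closed[OF compact_circle] circle_nonempty, of x]
    infdist_nonneg[of x \<C>] by linarith

lemma infdist_le_norm:
  assumes "s \<in> {0..2 * pi * R}"
  shows "infdist x \<C> \<le> norm (x - u s)"
  using infdist_le[of "u s" \<C> x] assms by (auto simp: round_circle_def dist_norm)

lemma off_circle_point:
  assumes "x \<notin> \<C>" "s \<in> {0..2 * pi * R}"
  shows "norm (x - u s) > 0"
  using assms infdist_le_norm[OF assms(2), of x] notin_circle_iff by auto

lemma continuous_on_gradV_integrand:
  assumes "x \<notin> \<C>"
  shows "continuous_on {0..2 * pi * R} (\<lambda>s. (lam / norm (x - u s) ^ 3) *\<^sub>R (x - u s))"
  using off_circle_point[OF assms]
  by (intro continuous_intros continuous_on_circle_point) auto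

text \<open>
  Differentiation under the integral sign on a ball around \<open>x\<close> that misses the circle.
\<close>

lemma GDERIV_V:
  assumes x: "x \<notin> \<C>"
  shows "GDERIV V x :> gradV x"
proof -
  have "open (- \<C>)" using compact_imp_closed[OF compact_circle] by auto
  with x obtain d where d: "d > 0" "ball x d \<subseteq> - \<C>"
    by (meson ComplI open_contains_ball)
  let ?I = "cbox 0 (2 * pi * R)"
  have pos: "norm (y - u s) > 0" if "y \<in> ball x d" "s \<in> ?I" for y s
    using d off_circle_point[of y s] that by auto
  let ?g = "\<lambda>y s. (lam / norm (y - u s) ^ 3) *\<^sub>R (y - u s)"
  have "((\<lambda>y. integral ?I (\<lambda>s. - (lam / norm (y - u s)))) has_derivative
      blinfun_apply (integral ?I (\<lambda>s. blinfun_inner_right (?g x s)))) (at x within ball x d)"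
  proof (rule leibniz_rule)
    fix y s assume ys: "y \<in> ball x d" "s \<in> ?I"
    have n: "y - u s \<noteq> 0" using pos[OF ys] by auto
    have "((\<lambda>y. norm (y - u s)) has_derivative (\<lambda>h. (h - 0) \<bullet> sgn (y - u s))) (at y within ball x d)"
      by (intro has_derivative_compose[where f = "\<lambda>y. y - u s", OF _ has_derivative_norm[OF n]]
            derivative_intros)
    then have "((\<lambda>y. - (lam / norm (y - u s))) has_derivative
        (\<lambda>h. lam * (h \<bullet> sgn (y - u s)) / (norm (y - u s))\<^sup>2)) (at y within ball x d)"
      using n by (auto intro!: derivative_eq_intros simp: power2_eq_square)
    then show "((\<lambda>y. - (lam / norm (y - u s))) has_derivative
        blinfun_apply (blinfun_inner_right (?g y s))) (at y within ball x d)"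
      by (rule has_derivative_eq_rhs)
         (simp add: fun_eq_iff inner_sgn_over_square inner_commute)
  next
    fix y assume "y \<in> ball x d"
    then show "(\<lambda>s. - (lam / norm (y - u s))) integrable_on ?I"
      using pos by (intro integrable_continuous continuous_intros continuous_on_circle_point) auto
  next
    have "continuous_on (ball x d \<times> ?I) (\<lambda>p. blinfun_inner_right (?g (fst p) (snd p)))"
      by (intro bounded_linear.continuous_on[OF bounded_linear_blinfun_inner_right]
            continuous_intros continuous_on_compose2[OF continuous_on_circle_point[of UNIV]])
         (use pos in auto)
    then show "continuous_on (ball x d \<times> ?I) (\<lambda>(y, s). blinfun_inner_right (?g y s))"
      by (simp add: case_prod_unfold)
  qed (use d in auto)
  moreover have "integral ?I (\<lambda>s. - (lam / norm (y - u s))) = V y" for y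
    by (simp add: circle_potential_def)
  moreover have "blinfun_apply (integral ?I (\<lambda>s. blinfun_inner_right (?g x s))) h = h \<bullet> gradV x" for h
  proof -
    have int: "?g x integrable_on ?I"
      using continuous_on_gradV_integrand[OF x] by (intro integrable_continuous) auto
    have "integral ?I (\<lambda>s. blinfun_inner_right (?g x s)) = blinfun_inner_right (integral ?I (?g x))"
      using integral_linear[OF int bounded_linear_blinfun_inner_right] by (simp add: o_def)
    then show ?thesis by (simp add: gradV_def inner_commute)
  qed
  ultimately have "(V has_derivative (\<lambda>h. h \<bullet> gradV x)) (at x within ball x d)"
    by (simp add: fun_eq_iff) (metis (no_types, lifting) ext has_derivative_eq_rhs)
  then show ?thesis using d(1) by (simp add: gderiv_def at_within_open[of x "ball x d"])
qed

lemma potential_lower_bound: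
  assumes "d > 0" "d \<le> infdist x \<C>"
  shows "- V x \<le> lam / d * (2 * pi * R)"
proof -
  have "norm (integral {0..2 * pi * R} (\<lambda>s. lam / norm (x - u s))) \<le> lam / d * (2 * pi * R - 0)"
  proof (rule integral_bound)
    have "x \<notin> \<C>" using assms notin_circle_iff[of x] by linarith
    then show "continuous_on {0..2 * pi * R} (\<lambda>s. lam / norm (x - u s))"
      using off_circle_point by (intro continuous_intros continuous_on_circle_point) auto
    fix s assume "s \<in> {0..2 * pi * R}"
    then have "d \<le> norm (x - u s)" using infdist_le_norm[of s x] assms by auto
    then show "norm (lam / norm (x - u s)) \<le> lam / d"
      using assms lam_pos by (auto intro!: divide_left_mono mult_pos_pos)
  qed (use R_pos in auto)
  then show ?thesis by (simp add: circle_potential_def)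
qed

lemma norm_gradV_le:
  assumes "d > 0" "d \<le> infdist x \<C>"
  shows "norm (gradV x) \<le> lam / d\<^sup>2 * (2 * pi * R)"
proof -
  have x: "x \<notin> \<C>" using assms notin_circle_iff[of x] by linarith
  have "norm (gradV x) \<le> lam / d\<^sup>2 * (2 * pi * R - 0)"
    unfolding gradV_def
  proof (rule integral_bound[OF _ continuous_on_gradV_integrand[OF x]])
    fix s assume s: "s \<in> {0..2 * pi * R}"
    then have "d \<le> norm (x - u s)" using infdist_le_norm[of s x] assms by auto
    then have "lam / (norm (x - u s))\<^sup>2 \<le> lam / d\<^sup>2"
      using assms lam_pos by (intro divide_left_mono mult_pos_pos power_mono) auto
    then show "norm ((lam / norm (x - u s) ^ 3) *\<^sub>R (x - u s)) \<le> lam / d\<^sup>2"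
      using lam_pos off_circle_point[OF x s]
      by (simp add: power2_eq_square power3_eq_cube)
  qed (use R_pos in auto)
  then show ?thesis by simp
qed

lemma gradV_lipschitz_on:
  assumes d: "d > 0" and A: "\<And>x. x \<in> A \<Longrightarrow> d \<le> infdist x \<C>"
  shows "(lam * (4 / d ^ 3) * (2 * pi * R))-lipschitz_on A gradV"
proof (rule lipschitz_onI)
  show "0 \<le> lam * (4 / d ^ 3) * (2 * pi * R)" using d lam_pos R_pos by simp
  fix x y assume xy: "x \<in> A" "y \<in> A"
  have x: "x \<notin> \<C>" "y \<notin> \<C>" using A xy d notin_circle_iff by fastforce+
  let ?g = "\<lambda>x s. (lam / norm (x - u s) ^ 3) *\<^sub>R (x - u s)"
  have int: "?g x integrable_on {0..2 * pi * R}" "?g y integrable_on {0..2 * pi * R}"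
    using x by (auto intro!: integrable_continuous_real continuous_on_gradV_integrand)
  have "norm (integral {0..2 * pi * R} (\<lambda>s. ?g x s - ?g y s))
      \<le> (lam * (4 / d ^ 3) * norm (x - y)) * (2 * pi * R - 0)"
  proof (rule integral_bound)
    show "continuous_on {0..2 * pi * R} (\<lambda>s. ?g x s - ?g y s)"
      using x by (intro continuous_on_diff continuous_on_gradV_integrand)
    fix s assume s: "s \<in> {0..2 * pi * R}"
    let ?k = "\<lambda>w::real^3. (1 / norm w ^ 3) *\<^sub>R w"
    have "?g x s - ?g y s = lam *\<^sub>R (?k (x - u s) - ?k (y - u s))"
      by (simp add: algebra_simps)
    then have "norm (?g x s - ?g y s) = lam * norm (?k (x - u s) - ?k (y - u s))"
      using lam_pos by (simp only: norm_scaleR abs_of_pos)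
    also have "\<dots> \<le> lam * (4 / d ^ 3 * norm ((x - u s) - (y - u s)))"
      using lam_pos d A[OF xy(1)] A[OF xy(2)] infdist_le_norm[OF s]
      by (intro mult_left_mono inverse_square_field_lipschitz) (auto intro: order_trans)
    finally show "norm (?g x s - ?g y s) \<le> lam * (4 / d ^ 3) * norm (x - y)" by simp
  qed (use R_pos in auto)
  then show "dist (gradV x) (gradV y) \<le> lam * (4 / d ^ 3) * (2 * pi * R) * dist x y"
    unfolding gradV_def dist_norm integral_diff[OF int, symmetric] by (simp add: mult_ac)
qed

text \<open>
  The force exerts no torque about the axis of the circle, by rotational symmetry.  Infinitesimally
  the symmetry reads as follows: the torque density at \<open>u s\<close> is the derivative of
  \<open>lam * R / norm (x - u s)\<close> with respect to \<open>s\<close>, because \<open>R\<close> times the unit tangent of the circle is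
  the rotation field of the axis and \<open>u s - c\<close> is orthogonal to it.  A total derivative integrates
  to zero over the closed curve.
\<close>

lemma gradV_torque_zero:
  assumes x: "x \<notin> \<C>"
  shows "((x - c) \<bullet> e1) * (gradV x \<bullet> e2) - ((x - c) \<bullet> e2) * (gradV x \<bullet> e1) = 0"
proof -
  define X Y where "X = (x - c) \<bullet> e1" and "Y = (x - c) \<bullet> e2"
  let ?I = "{0..2 * pi * R}"
  let ?g = "\<lambda>s. (lam / norm (x - u s) ^ 3) *\<^sub>R (x - u s)"
  have int: "(?g has_integral gradV x) ?I"
    unfolding gradV_def
    by (intro integrable_integral integrable_continuous_real continuous_on_gradV_integrand x)
  have "bounded_linear (\<lambda>w. X * (w \<bullet> e2) - Y * (w \<bullet> e1))"
    by (intro bounded_linear_intros)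
  from has_integral_linear[OF int this]
  have 1: "((\<lambda>s. X * (?g s \<bullet> e2) - Y * (?g s \<bullet> e1)) has_integral
      X * (gradV x \<bullet> e2) - Y * (gradV x \<bullet> e1)) ?I"
    by (simp add: o_def)
  have comp: "(x - u s) \<bullet> e1 = X - R * cos (s / R)" "(x - u s) \<bullet> e2 = Y - R * sin (s / R)" for s
    by (simp_all add: X_def Y_def circle_point_def algebra_simps inner_add_left inner_diff_left)
  have "((\<lambda>s. X * (?g s \<bullet> e2) - Y * (?g s \<bullet> e1)) has_integral
      lam * R / norm (x - u (2 * pi * R)) - lam * R / norm (x - u 0)) ?I"
  proof (rule fundamental_theorem_of_calculus)
    fix s assume s: "s \<in> ?I"
    have n: "x - u s \<noteq> 0" using off_circle_point[OF x s] by auto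
    let ?w = "(- sin (s / R)) *\<^sub>R e1 + cos (s / R) *\<^sub>R e2"
    have u': "(u has_derivative (\<lambda>h. h *\<^sub>R ?w)) (at s within ?I)"
      unfolding circle_point_def[abs_def]
      using R_pos by (auto intro!: derivative_eq_intros simp: algebra_simps)
    have dot: "(x - u s) \<bullet> ?w = Y * cos (s / R) - X * sin (s / R)"
    proof -
      have "(x - u s) \<bullet> ?w = - sin (s / R) * ((x - u s) \<bullet> e1) + cos (s / R) * ((x - u s) \<bullet> e2)"
        by (simp add: inner_add_right inner_diff_right)
      then show ?thesis unfolding comp by (simp add: algebra_simps)
    qed
    have "((\<lambda>s. norm (x - u s)) has_derivative (\<lambda>h. (0 - h *\<^sub>R ?w) \<bullet> sgn (x - u s))) (at s within ?I)"
      by (intro has_derivative_compose[where f = "\<lambda>s. x - u s", OF _ has_derivative_norm[OF n]]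
            derivative_intros u')
    then have "((\<lambda>s. lam * R / norm (x - u s)) has_derivative
        (\<lambda>h. lam * R * (h *\<^sub>R ?w \<bullet> sgn (x - u s)) / (norm (x - u s))\<^sup>2)) (at s within ?I)"
      using n by (auto intro!: derivative_eq_intros simp: power2_eq_square)
    moreover have "lam * R * (h *\<^sub>R ?w \<bullet> sgn (x - u s)) / (norm (x - u s))\<^sup>2
        = h *\<^sub>R (X * (?g s \<bullet> e2) - Y * (?g s \<bullet> e1))" for h
    proof -
      have "lam * R * (h *\<^sub>R ?w \<bullet> sgn (x - u s)) / (norm (x - u s))\<^sup>2
          = h * (lam * R / norm (x - u s) ^ 3) * ((x - u s) \<bullet> ?w)"
        using inner_sgn_over_square[of "lam * R * h" ?w "x - u s"]
        by (simp add: inner_commute[of _ "x - u s"] mult_ac)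
      also have "\<dots> = h * (lam / norm (x - u s) ^ 3) *
          (X * ((x - u s) \<bullet> e2) - Y * ((x - u s) \<bullet> e1))"
        unfolding dot comp by (simp add: algebra_simps)
      also have "\<dots> = h * (X * (lam / norm (x - u s) ^ 3 * ((x - u s) \<bullet> e2))
          - Y * (lam / norm (x - u s) ^ 3 * ((x - u s) \<bullet> e1)))"
        by (simp only: right_diff_distrib mult_ac)
      finally show ?thesis by simp
    qed
    ultimately show "((\<lambda>s. lam * R / norm (x - u s)) has_vector_derivative
        X * (?g s \<bullet> e2) - Y * (?g s \<bullet> e1)) (at s within ?I)"
      unfolding has_vector_derivative_def by (simp only:)
  qed (use R_pos in simp)
  moreover have "u (2 * pi * R) = u 0" using R_pos by (simp add: circle_point_def)
  ultimately have "X * (gradV x \<bullet> e2) - Y * (gradV x \<bullet> e1) = 0"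
    using has_integral_unique[OF 1] by auto
  then show ?thesis by (simp add: X_def Y_def)
qed

section \<open>Cylindrical coordinates\<close>

lemma norm_minus_projection:
  "(norm (w - (w \<bullet> e1) *\<^sub>R e1 - (w \<bullet> e2) *\<^sub>R e2))\<^sup>2
     = (norm w)\<^sup>2 - ((w \<bullet> e1)\<^sup>2 + (w \<bullet> e2)\<^sup>2)"
  unfolding power2_norm_eq_inner
  by (simp add: inner_diff_left inner_diff_right inner_commute[of e1 w] inner_commute[of e2 w] power2_eq_square)

text \<open>
  Both the radial offset \<open>\<rho> - R\<close> and the height over the plane of the circle are at most the
  distance to the nearest point of the circle: the first since projecting to the plane does not
  increase distances, the second since the nearest point lies in the plane.
\<close>

lemma cylindrical_coordinates_near_circle:
  fixes x :: "real^3"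
  defines "X \<equiv> (x - c) \<bullet> e1" and "Y \<equiv> (x - c) \<bullet> e2"
  shows "\<bar>sqrt (X\<^sup>2 + Y\<^sup>2) - R\<bar> \<le> infdist x \<C>"
    and "norm (x - (c + X *\<^sub>R e1 + Y *\<^sub>R e2)) \<le> infdist x \<C>"
proof -
  obtain p where "p \<in> \<C>" and p: "infdist x \<C> = dist x p"
    using infdist_attains_inf[OF compact_imp_closed[OF compact_circle] circle_nonempty] by blast
  then obtain s where s: "p = u s" by (auto simp: round_circle_def)
  define P Q w where "P = R * cos (s / R)" and "Q = R * sin (s / R)" and "w = x - p"
  have pc: "p = c + P *\<^sub>R e1 + Q *\<^sub>R e2" by (simp add: s circle_point_def P_def Q_def)
  have w: "w \<bullet> e1 = X - P" "w \<bullet> e2 = Y - Q"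
    by (simp_all add: w_def pc X_def Y_def inner_diff_left inner_add_left)
  have proj: "(norm (w - (X - P) *\<^sub>R e1 - (Y - Q) *\<^sub>R e2))\<^sup>2
      = (norm w)\<^sup>2 - ((X - P)\<^sup>2 + (Y - Q)\<^sup>2)"
    using norm_minus_projection[of w] by (simp add: w)
  have "P\<^sup>2 + Q\<^sup>2 = R\<^sup>2 * ((cos (s / R))\<^sup>2 + (sin (s / R))\<^sup>2)"
    unfolding P_def Q_def by (simp only: power_mult_distrib distrib_left)
  then have PQ: "norm (P, Q) = R" using R_pos by (simp add: norm_Pair)
  have "\<bar>norm (X, Y) - norm (P, Q)\<bar> \<le> norm ((X, Y) - (P, Q))" by (rule norm_triangle_ineq3)
  also have "\<dots> \<le> norm w"
    unfolding norm_Pair diff_Pair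
    by (rule real_le_lsqrt) (use proj zero_le_power2[of "norm (w - (X - P) *\<^sub>R e1 - (Y - Q) *\<^sub>R e2)"] in auto)
  finally show "\<bar>sqrt (X\<^sup>2 + Y\<^sup>2) - R\<bar> \<le> infdist x \<C>"
    unfolding PQ by (simp add: norm_Pair p dist_norm w_def)
  have "norm (w - (X - P) *\<^sub>R e1 - (Y - Q) *\<^sub>R e2) \<le> norm w"
    by (rule power2_le_imp_le) (use proj in auto)
  also have "w - (X - P) *\<^sub>R e1 - (Y - Q) *\<^sub>R e2 = x - (c + X *\<^sub>R e1 + Y *\<^sub>R e2)"
    by (simp add: w_def pc algebra_simps)
  finally show "norm (x - (c + X *\<^sub>R e1 + Y *\<^sub>R e2)) \<le> infdist x \<C>"
    by (simp add: p dist_norm w_def)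
qed

end

text \<open>
  In polar coordinates \<open>J = \<rho>\<^sup>2 * \<theta>'\<close>, so a constant \<open>J\<close> and a lower bound on \<open>\<rho>\<close> bound the angular
  velocity, and the angle converges in finite time although \<open>X'\<close> and \<open>Y'\<close> may be unbounded.
  Working with the component \<open>X / \<rho>\<close> of the direction, whose derivative is \<open>- J * Y / \<rho> ^ 3\<close>,
  avoids choosing a continuous angle.
\<close>

lemma planar_direction_limit:
  fixes X Y X' Y' :: "real \<Rightarrow> real"
  assumes "t0 < b" and "m > 0"
    and X: "\<And>t. t \<in> {t0<..<b} \<Longrightarrow> (X has_real_derivative X' t) (at t)"
    and Y: "\<And>t. t \<in> {t0<..<b} \<Longrightarrow> (Y has_real_derivative Y' t) (at t)"
    and J: "\<And>t. t \<in> {t0<..<b} \<Longrightarrow> X t * Y' t - Y t * X' t = J"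
    and m: "\<And>t. t \<in> {t0<..<b} \<Longrightarrow> m \<le> sqrt ((X t)\<^sup>2 + (Y t)\<^sup>2)"
  obtains l where "((\<lambda>t. X t / sqrt ((X t)\<^sup>2 + (Y t)\<^sup>2)) \<longlongrightarrow> l) (at_left b)"
proof (rule bounded_derivative_limit_at_left[OF assms(1)])
  fix t assume t: "t \<in> {t0<..<b}"
  define \<rho> where "\<rho> = sqrt ((X t)\<^sup>2 + (Y t)\<^sup>2)"
  have "m \<le> \<rho>" using m[OF t] by (simp add: \<rho>_def)
  with assms(2) have \<rho>: "0 < \<rho>" "m \<le> \<rho>" by linarith+
  then have pos: "0 < (X t)\<^sup>2 + (Y t)\<^sup>2" by (simp add: \<rho>_def)
  then have \<rho>2: "\<rho>\<^sup>2 = (X t)\<^sup>2 + (Y t)\<^sup>2" by (simp add: \<rho>_def)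
  have "((\<lambda>t. (X t)\<^sup>2 + (Y t)\<^sup>2) has_real_derivative 2 * X t * X' t + 2 * Y t * Y' t) (at t)"
    by (auto intro!: derivative_eq_intros X[OF t] Y[OF t])
  from DERIV_chain2[OF DERIV_real_sqrt[OF pos] this]
  have "((\<lambda>t. sqrt ((X t)\<^sup>2 + (Y t)\<^sup>2)) has_real_derivative (X t * X' t + Y t * Y' t) / \<rho>) (at t)"
    by (rule DERIV_cong) (use \<rho> in \<open>simp add: \<rho>_def[symmetric] field_simps\<close>)
  from DERIV_divide[OF X[OF t] this]
  have "((\<lambda>t. X t / sqrt ((X t)\<^sup>2 + (Y t)\<^sup>2)) has_real_derivative
      (X' t * \<rho> - X t * ((X t * X' t + Y t * Y' t) / \<rho>)) / (\<rho> * \<rho>)) (at t)"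
    using \<rho> by (simp add: \<rho>_def[symmetric])
  moreover have "(X' t * \<rho> - X t * ((X t * X' t + Y t * Y' t) / \<rho>)) / (\<rho> * \<rho>) = - J * Y t / \<rho> ^ 3"
  proof -
    have "X' t * \<rho>\<^sup>2 - X t * (X t * X' t + Y t * Y' t) = - J * Y t"
      unfolding \<rho>2 J[OF t, symmetric] by (simp add: algebra_simps power2_eq_square)
    moreover have "(X' t * \<rho> - X t * ((X t * X' t + Y t * Y' t) / \<rho>)) / (\<rho> * \<rho>)
        = (X' t * \<rho>\<^sup>2 - X t * (X t * X' t + Y t * Y' t)) / \<rho> ^ 3"
      using \<rho> by (simp add: field_simps power2_eq_square power3_eq_cube)
    ultimately show ?thesis by simp
  qed
  ultimately show "((\<lambda>t. X t / sqrt ((X t)\<^sup>2 + (Y t)\<^sup>2)) has_vector_derivative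
      - J * Y t / sqrt ((X t)\<^sup>2 + (Y t)\<^sup>2) ^ 3) (at t)"
    by (simp add: \<rho>_def has_real_derivative_iff_has_vector_derivative)
  have "\<bar>Y t\<bar> \<le> \<rho>" unfolding \<rho>_def by (intro real_le_rsqrt) simp
  then have "\<bar>J\<bar> * \<bar>Y t\<bar> / \<rho> ^ 3 \<le> \<bar>J\<bar> * \<rho> / \<rho> ^ 3"
    using \<rho> by (intro divide_right_mono mult_left_mono) auto
  also have "\<dots> = \<bar>J\<bar> / \<rho>\<^sup>2" using \<rho> by (simp add: power2_eq_square power3_eq_cube)
  also have "\<dots> \<le> \<bar>J\<bar> / m\<^sup>2"
    using \<rho> assms(2) by (intro divide_left_mono power_mono) auto
  finally show "norm (- J * Y t / sqrt ((X t)\<^sup>2 + (Y t)\<^sup>2) ^ 3) \<le> \<bar>J\<bar> / m\<^sup>2"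
    using \<rho> by (simp add: \<rho>_def[symmetric] abs_mult)
qed (use that in blast)

section \<open>Conservation laws\<close>

context homogeneous_circle
begin

text \<open>
  Newton's equation as a first-order system with an explicit right-hand side, the form to which
  \<open>ode_continuation\<close> applies.
\<close>

definition motion_on :: "real set \<Rightarrow> (real \<Rightarrow> real^3) \<Rightarrow> (real \<Rightarrow> real^3) \<Rightarrow> bool" where
  "motion_on I r v \<longleftrightarrow> (\<forall>t\<in>I. r t \<notin> \<C> \<and> (r has_vector_derivative v t) (at t) \<and>
     (v has_vector_derivative - gradV (r t)) (at t))"

lemma newton_solution_on_iff_motion_on:
  "newton_solution_on \<C> V I r \<longleftrightarrow> (\<exists>v. motion_on I r v)"
proof
  assume "newton_solution_on \<C> V I r"
  then obtain v where off: "\<forall>t\<in>I. r t \<notin> \<C>"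
    and v: "\<forall>t\<in>I. (r has_vector_derivative v t) (at t) \<and>
        (\<exists>g. GDERIV V (r t) :> g \<and> (v has_vector_derivative - g) (at t))"
    by (auto simp: newton_solution_on_def)
  have "g = gradV (r t)" if "t \<in> I" "GDERIV V (r t) :> g" for g t
  proof -
    have "(\<lambda>h. h \<bullet> g) = (\<lambda>h. h \<bullet> gradV (r t))"
      using that GDERIV_V[of "r t"] off unfolding gderiv_def by (blast intro: has_derivative_unique)
    then have "h \<bullet> g = h \<bullet> gradV (r t)" for h by (rule fun_cong)
    then show ?thesis by (metis vector_eq_ldot)
  qed
  then have "motion_on I r v" using off v unfolding motion_on_def by metis
  then show "\<exists>v. motion_on I r v" by blast
next
  assume "\<exists>v. motion_on I r v"
  then show "newton_solution_on \<C> V I r"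
    unfolding motion_on_def newton_solution_on_def using GDERIV_V by metis
qed

lemma motion_onD:
  assumes "motion_on I r v" "t \<in> I"
  shows "r t \<notin> \<C>" "(r has_vector_derivative v t) (at t)"
    "(v has_vector_derivative - gradV (r t)) (at t)"
  using assms by (auto simp: motion_on_def)

lemma energy_conserved:
  assumes "motion_on {t0<..<b} r v"
  obtains h where "\<And>t. t \<in> {t0<..<b} \<Longrightarrow> (norm (v t))\<^sup>2 / 2 + V (r t) = h"
proof (rule has_vector_derivative_zero_constant[of "{t0<..<b}" "\<lambda>t. (norm (v t))\<^sup>2 / 2 + V (r t)"])
  fix t assume t: "t \<in> {t0<..<b}"
  note r = motion_onD[OF assms t]
  have "((\<lambda>t. v t \<bullet> v t) has_vector_derivative v t \<bullet> (- gradV (r t)) + (- gradV (r t)) \<bullet> v t) (at t)"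
    by (rule bounded_bilinear.has_vector_derivative[OF bounded_bilinear_inner r(3) r(3)])
  then have kin: "((\<lambda>t. (norm (v t))\<^sup>2 / 2) has_vector_derivative - (v t \<bullet> gradV (r t))) (at t)"
    using has_vector_derivative_divide[of "\<lambda>t. v t \<bullet> v t" _ _ 2]
    by (force simp: power2_norm_eq_inner inner_commute)
  have "((\<lambda>t. V (r t)) has_derivative (\<lambda>h. (h *\<^sub>R v t) \<bullet> gradV (r t))) (at t)"
    using has_derivative_compose[OF r(2)[unfolded has_vector_derivative_def]
        GDERIV_V[OF r(1), unfolded gderiv_def]] .
  then have "((\<lambda>t. V (r t)) has_vector_derivative v t \<bullet> gradV (r t)) (at t)"
    by (simp add: has_vector_derivative_def)
  from has_vector_derivative_add[OF kin this]
  show "((\<lambda>t. (norm (v t))\<^sup>2 / 2 + V (r t)) has_vector_derivative 0) (at t within {t0<..<b})"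
    by (simp add: has_vector_derivative_at_within)
qed (use that in auto)

lemma angular_momentum_conserved:
  assumes "motion_on {t0<..<b} r v"
  obtains J where
    "\<And>t. t \<in> {t0<..<b} \<Longrightarrow> ((r t - c) \<bullet> e1) * (v t \<bullet> e2) - ((r t - c) \<bullet> e2) * (v t \<bullet> e1) = J"
proof (rule has_vector_derivative_zero_constant[of "{t0<..<b}"
      "\<lambda>t. ((r t - c) \<bullet> e1) * (v t \<bullet> e2) - ((r t - c) \<bullet> e2) * (v t \<bullet> e1)"])
  fix t assume t: "t \<in> {t0<..<b}"
  note r = motion_onD[OF assms t]
  note inner' = bounded_linear.has_vector_derivative[OF bounded_linear_inner_left]
  have "((\<lambda>t. r t - c) has_vector_derivative v t) (at t)"
    using has_vector_derivative_diff[OF r(2) has_vector_derivative_const[of c]] by simp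
  from has_vector_derivative_diff[OF
      has_vector_derivative_mult[OF inner'[OF this, of e1] inner'[OF r(3), of e2]]
      has_vector_derivative_mult[OF inner'[OF this, of e2] inner'[OF r(3), of e1]]]
  have "((\<lambda>t. ((r t - c) \<bullet> e1) * (v t \<bullet> e2) - ((r t - c) \<bullet> e2) * (v t \<bullet> e1)) has_vector_derivative
      - (((r t - c) \<bullet> e1) * (gradV (r t) \<bullet> e2) - ((r t - c) \<bullet> e2) * (gradV (r t) \<bullet> e1))) (at t)"
    by (simp add: algebra_simps)
  then show "((\<lambda>t. ((r t - c) \<bullet> e1) * (v t \<bullet> e2) - ((r t - c) \<bullet> e2) * (v t \<bullet> e1))
      has_vector_derivative 0) (at t within {t0<..<b})"
    unfolding gradV_torque_zero[OF r(1)] by (simp add: has_vector_derivative_at_within)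
qed (use that in auto)

section \<open>Behaviour at the end of a finite interval\<close>

text \<open>
  By conservation of energy the speed can only become large where \<open>- V\<close> does, that is, close to the
  circle.
\<close>

lemma speed_bounded_off_circle:
  assumes "motion_on {t0<..<b} r v" "d > 0"
  obtains M where "M > 0"
    "\<And>t. t \<in> {t0<..<b} \<Longrightarrow> d \<le> infdist (r t) \<C> \<Longrightarrow> norm (v t) \<le> M"
proof -
  obtain h where h: "\<And>t. t \<in> {t0<..<b} \<Longrightarrow> (norm (v t))\<^sup>2 / 2 + V (r t) = h"
    using energy_conserved[OF assms(1)] by blast
  define K where "K = 2 * (h + lam / d * (2 * pi * R))"
  show ?thesis
  proof (rule that[of "1 + \<bar>K\<bar>"])
    fix t assume t: "t \<in> {t0<..<b}" "d \<le> infdist (r t) \<C>"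
    have "(norm (v t))\<^sup>2 \<le> K"
      using h[OF t(1)] potential_lower_bound[OF assms(2) t(2)] by (simp add: K_def)
    also have "K \<le> (1 + \<bar>K\<bar>)\<^sup>2"
      using zero_le_power2[of K] abs_ge_self[of K] abs_ge_zero[of K]
      unfolding power2_sum power2_abs one_power2 by linarith
    finally show "norm (v t) \<le> 1 + \<bar>K\<bar>" by (rule power2_le_imp_le) simp
  qed simp
qed

text \<open>
  If the distance to the circle does not tend to zero, it is at least \<open>2 * d\<close> at times \<open>t1\<close>
  arbitrarily close to \<open>b\<close>.  As long as it stays above \<open>d\<close> the speed is at most \<open>M\<close>, so coming down
  to \<open>d\<close> takes at least time \<open>d / M\<close>; when \<open>t1\<close> is closer than that to \<open>b\<close>, there is no time left.
\<close>

lemma stays_off_circle: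
  assumes mot: "motion_on {t0<..<b} r v" and "t0 < b"
    and ncoll: "\<not> ((\<lambda>t. infdist (r t) \<C>) \<longlongrightarrow> 0) (at_left b)"
  obtains d t1 where "d > 0" "t0 \<le> t1" "t1 < b"
    "\<And>t. t \<in> {t1<..<b} \<Longrightarrow> d \<le> infdist (r t) \<C>"
proof -
  obtain e where e: "e > 0" "\<not> eventually (\<lambda>t. infdist (r t) \<C> < e) (at_left b)"
    using ncoll by (auto simp: tendsto_iff infdist_nonneg)
  define d where "d = e / 2"
  have d: "d > 0" using e by (simp add: d_def)
  obtain M where M: "M > 0"
    "\<And>t. t \<in> {t0<..<b} \<Longrightarrow> d \<le> infdist (r t) \<C> \<Longrightarrow> norm (v t) \<le> M"
    using speed_bounded_off_circle[OF mot d] by blast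
  have near_b: "\<exists>t>s. t < b \<and> 2 * d \<le> infdist (r t) \<C>" if "s < b" for s
    using e(2) that unfolding eventually_at_left_field d_def
    by simp (metis not_less)
  have "max t0 (b - d / M) < b" using assms(2) d M by simp
  from near_b[OF this] obtain t1 where t1: "max t0 (b - d / M) < t1" "t1 < b" "infdist (r t1) \<C> \<ge> 2 * d"
    by blast
  have cont: "continuous_on {t0<..<b} r"
    using motion_onD(2)[OF mot] has_vector_derivative_continuous
    by (intro continuous_at_imp_continuous_on) blast
  have "d \<le> infdist (r t) \<C>" if t: "t \<in> {t1<..<b}" for t
  proof (rule ccontr)
    assume less: "\<not> ?thesis"
    \<comment> \<open>\<open>s\<close> is the first time after \<open>t1\<close> at which the distance is at most \<open>d\<close>.\<close>
    let ?S = "{s \<in> {t1..t}. infdist (r s) \<C> \<in> {..d}}"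
    have cont1: "continuous_on {t1..t} r"
      by (rule continuous_on_subset[OF cont]) (use t1 t in auto)
    have "closed ?S"
      by (intro continuous_closed_preimage[unfolded vimage_def Int_def mem_Collect_eq]
          continuous_intros cont1)
    moreover have "bounded ?S" by (rule bounded_subset[of "{t1..t}"]) auto
    ultimately have "compact ?S" by (simp add: compact_eq_bounded_closed)
    moreover have "?S \<noteq> {}" using less t by auto
    ultimately obtain s where s: "s \<in> ?S" "\<And>x. x \<in> ?S \<Longrightarrow> s \<le> x"
      using compact_attains_inf[of ?S] by blast
    have "s \<noteq> t1" using s(1) t1 d by auto
    then have st: "t1 < s" "s \<le> t" using s(1) by auto
    have "\<exists>x\<in>{t1<..<s}. norm (r s - r t1) \<le> norm ((s - t1) *\<^sub>R v x)"
    proof (rule mvt_general[OF st(1)])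
      show "continuous_on {t1..s} r" by (rule continuous_on_subset[OF cont1]) (use st in auto)
      fix x assume "t1 < x" "x < s"
      then show "(r has_derivative (\<lambda>h. h *\<^sub>R v x)) (at x)"
        using motion_onD(2)[OF mot, of x] t1 t st by (auto simp: has_vector_derivative_def)
    qed
    then obtain x where x: "t1 < x" "x < s" "norm (r s - r t1) \<le> norm ((s - t1) *\<^sub>R v x)" by auto
    have "d \<le> infdist (r x) \<C>" using s(2)[of x] x st by force
    then have vx: "norm (v x) \<le> M" using M(2)[of x] x t1 t st by auto
    have "norm (r s - r t1) \<le> (s - t1) * norm (v x)" using x(3) st by simp
    also have "\<dots> \<le> (s - t1) * M" using vx st by (intro mult_left_mono) auto
    also have "\<dots> < d / M * M"
      using M(1) t1(1) st t by (intro mult_strict_right_mono) auto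
    also have "\<dots> = d" using M(1) by simp
    finally have "dist (r t1) (r s) < d" by (simp add: dist_norm norm_minus_commute)
    moreover have "infdist (r t1) \<C> \<le> infdist (r s) \<C> + dist (r t1) (r s)" by (rule infdist_triangle)
    ultimately show False using s(1) t1(3) by auto
  qed
  then show ?thesis using that[of d t1] d t1 by auto
qed

text \<open>
  Off the circle speed and acceleration are bounded, so position and velocity converge at \<open>b\<close>, to a
  point of phase space around which the force is Lipschitz.
\<close>

lemma continuation_off_circle:
  assumes mot: "motion_on {t0<..<b} r v" and "t0 < b"
    and ncoll: "\<not> ((\<lambda>t. infdist (r t) \<C>) \<longlongrightarrow> 0) (at_left b)"
  obtains t1 \<tau> q w where "t1 < b" "\<tau> > 0" "\<And>t. t < b \<Longrightarrow> q t = r t" "motion_on {t1<..<b+\<tau>} q w"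
proof -
  obtain d t1 where d: "d > 0" and t1: "t0 \<le> t1" "t1 < b"
    and off: "\<And>t. t \<in> {t1<..<b} \<Longrightarrow> d \<le> infdist (r t) \<C>"
    using stays_off_circle[OF assms] by blast
  have in_t0: "t \<in> {t0<..<b}" if "t \<in> {t1<..<b}" for t using that t1 by auto
  obtain M where M: "\<And>t. t \<in> {t0<..<b} \<Longrightarrow> d \<le> infdist (r t) \<C> \<Longrightarrow> norm (v t) \<le> M"
    using speed_bounded_off_circle[OF mot d] by blast
  obtain x0 where x0: "(r \<longlongrightarrow> x0) (at_left b)"
    by (rule bounded_derivative_limit_at_left[OF t1(2), of r v M])
       (use motion_onD(2)[OF mot in_t0] M[OF in_t0] off in auto)
  obtain v0 where v0: "(v \<longlongrightarrow> v0) (at_left b)"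
    by (rule bounded_derivative_limit_at_left[OF t1(2), of v "\<lambda>t. - gradV (r t)"
          "lam / d\<^sup>2 * (2 * pi * R)"])
       (use motion_onD(3)[OF mot in_t0] norm_gradV_le[OF d off] in auto)
  have "eventually (\<lambda>t. d \<le> infdist (r t) \<C>) (at_left b)"
    unfolding eventually_at_left_field using t1 off by (intro exI[of _ t1]) auto
  then have "d \<le> infdist x0 \<C>"
    by (intro tendsto_lowerbound[OF tendsto_infdist[OF x0]]) auto
  then have near: "d / 2 \<le> infdist x \<C>" if "dist x0 x \<le> d / 2" for x
    using infdist_triangle[of x0 \<C> x] that by auto
  define L where "L = lam * (4 / (d / 2) ^ 3) * (2 * pi * R)"
  have lip: "L-lipschitz_on (cball x0 (d / 2)) gradV"
    unfolding L_def by (rule gradV_lipschitz_on) (use d near in auto)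
  have L: "L \<ge> 0" using lip by (rule lipschitz_on_nonneg)
  define G where "G = (\<lambda>z :: (real^3) \<times> (real^3). (snd z, - gradV (fst z)))"
  have lipG: "(1 + L)-lipschitz_on (cball (x0, v0) (d / 2)) G"
  proof (rule lipschitz_onI)
    fix y z assume yz: "y \<in> cball (x0, v0) (d / 2)" "z \<in> cball (x0, v0) (d / 2)"
    have "fst y \<in> cball x0 (d / 2)" "fst z \<in> cball x0 (d / 2)"
      using yz dist_fst_le[of "(x0, v0)" y] dist_fst_le[of "(x0, v0)" z] by auto
    then have "dist (gradV (fst y)) (gradV (fst z)) \<le> L * dist (fst y) (fst z)"
      by (rule lipschitz_onD[OF lip])
    also have "\<dots> \<le> L * dist y z" using L by (intro mult_left_mono dist_fst_le)
    finally have grad: "dist (gradV (fst y)) (gradV (fst z)) \<le> L * dist y z" .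
    have "dist (G y) (G z) \<le> dist (snd y) (snd z) + dist (gradV (fst y)) (gradV (fst z))"
      unfolding G_def dist_Pair_Pair dist_minus
      by (rule order_trans[OF sqrt_sum_squares_le_sum]) auto
    also have "\<dots> \<le> dist y z + L * dist y z" by (intro add_mono dist_snd_le grad)
    finally show "dist (G y) (G z) \<le> (1 + L) * dist y z" by (simp add: algebra_simps)
  qed (use L in simp)
  obtain \<tau> y where \<tau>: "\<tau> > 0" and yz: "\<And>t. t < b \<Longrightarrow> y t = (r t, v t)"
    and yB: "\<And>t. t \<in> {b..<b+\<tau>} \<Longrightarrow> y t \<in> cball (x0, v0) (d / 2)"
    and y: "\<And>t. t \<in> {t1<..<b+\<tau>} \<Longrightarrow> (y has_vector_derivative G (y t)) (at t)"
  proof (rule ode_continuation[OF t1(2) _ lipG, of "\<lambda>t. (r t, v t)"])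
    show "((\<lambda>t. (r t, v t)) has_vector_derivative G (r t, v t)) (at t)" if "t \<in> {t1<..<b}" for t
      unfolding G_def fst_conv snd_conv
      by (intro has_vector_derivative_Pair motion_onD[OF mot in_t0] that)
    show "((\<lambda>t. (r t, v t)) \<longlongrightarrow> (x0, v0)) (at_left b)" by (intro tendsto_Pair x0 v0)
  qed (use d in auto)
  show ?thesis
  proof (rule that[OF t1(2) \<tau>])
    show "fst (y t) = r t" if "t < b" for t using yz[OF that] by simp
    show "motion_on {t1<..<b+\<tau>} (\<lambda>t. fst (y t)) (\<lambda>t. snd (y t))"
      unfolding motion_on_def
    proof (intro ballI conjI)
      fix t assume t: "t \<in> {t1<..<b+\<tau>}"
      show "fst (y t) \<notin> \<C>"
      proof (cases "t < b")
        case True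
        then show ?thesis using yz[OF True] motion_onD(1)[OF mot in_t0] t by auto
      next
        case False
        then have "dist x0 (fst (y t)) \<le> d / 2"
          using yB[of t] t dist_fst_le[of "(x0, v0)" "y t"] by auto
        then show ?thesis using near d notin_circle_iff by fastforce
      qed
      show "((\<lambda>t. fst (y t)) has_vector_derivative snd (y t)) (at t)"
        using bounded_linear.has_vector_derivative[OF bounded_linear_fst y[OF t]] by (simp add: G_def)
      show "((\<lambda>t. snd (y t)) has_vector_derivative - gradV (fst (y t))) (at t)"
        using bounded_linear.has_vector_derivative[OF bounded_linear_snd y[OF t]] by (simp add: G_def)
    qed
  qed
qed

text \<open>
  Approaching the circle only fixes the distance \<open>\<rho>\<close> from the axis and the height; the position along
  the circle could still drift.  Conservation of the angular momentum about the axis excludes this: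
  \<open>\<rho>\<close> is close to \<open>R > 0\<close>, so the angular velocity is bounded.
\<close>

lemma collision_if_distance_tendsto_zero:
  assumes mot: "motion_on {t0<..<b} r v" and "t0 < b"
    and coll: "((\<lambda>t. infdist (r t) \<C>) \<longlongrightarrow> 0) (at_left b)"
  shows "\<exists>x\<in>\<C>. (r \<longlongrightarrow> x) (at_left b)"
proof -
  define X Y where "X t = (r t - c) \<bullet> e1" and "Y t = (r t - c) \<bullet> e2" for t
  let ?\<rho> = "\<lambda>t. sqrt ((X t)\<^sup>2 + (Y t)\<^sup>2)"
  note near = cylindrical_coordinates_near_circle[of "r _", folded X_def Y_def]
  have \<rho>: "(?\<rho> \<longlongrightarrow> R) (at_left b)"
    by (rule Lim_transform[OF tendsto_const], rule Lim_null_comparison[OF _ coll])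
       (use near(1) in \<open>auto simp: abs_minus_commute\<close>)
  have "eventually (\<lambda>t. R / 2 < ?\<rho> t) (at_left b)"
    using order_tendstoD(1)[OF \<rho>, of "R / 2"] R_pos by simp
  then obtain t1 where t1: "t1 < b" "\<And>t. t1 < t \<Longrightarrow> t < b \<Longrightarrow> R / 2 < ?\<rho> t"
    unfolding eventually_at_left_field by auto
  define t2 where "t2 = max t0 t1"
  have t2: "t2 < b" using t1 assms(2) by (simp add: t2_def)
  have in_t0: "t \<in> {t0<..<b}" and big: "R / 2 \<le> ?\<rho> t" if "t \<in> {t2<..<b}" for t
    using that t1(2)[of t] by (auto simp: t2_def)
  obtain J where J: "\<And>t. t \<in> {t0<..<b} \<Longrightarrow> X t * (v t \<bullet> e2) - Y t * (v t \<bullet> e1) = J"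
    using angular_momentum_conserved[OF mot] unfolding X_def Y_def by blast
  have der: "((\<lambda>t. (r t - c) \<bullet> e) has_real_derivative v t \<bullet> e) (at t)" if "t \<in> {t2<..<b}" for t e
  proof -
    have "((\<lambda>t. r t - c) has_vector_derivative v t) (at t)"
      using has_vector_derivative_diff[OF motion_onD(2)[OF mot in_t0[OF that]]
          has_vector_derivative_const[of c]] by simp
    then show ?thesis
      unfolding has_real_derivative_iff_has_vector_derivative
      by (rule bounded_linear.has_vector_derivative[OF bounded_linear_inner_left])
  qed
  have half: "R / 2 > 0" using R_pos by simp
  obtain l1 where l1: "((\<lambda>t. X t / ?\<rho> t) \<longlongrightarrow> l1) (at_left b)"
    using planar_direction_limit[OF t2 half, of X "\<lambda>t. v t \<bullet> e1" Y "\<lambda>t. v t \<bullet> e2" J]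
      der[of _ e1, folded X_def] der[of _ e2, folded Y_def] J[OF in_t0] big by blast
  \<comment> \<open>Exchanging the two coordinates reverses the sign of the angular momentum.\<close>
  have "Y t * (v t \<bullet> e1) - X t * (v t \<bullet> e2) = - J" if "t \<in> {t2<..<b}" for t
    using J[OF in_t0[OF that]] by simp
  then obtain l2 where l2: "((\<lambda>t. Y t / ?\<rho> t) \<longlongrightarrow> l2) (at_left b)"
    using planar_direction_limit[OF t2 half, of Y "\<lambda>t. v t \<bullet> e2" X "\<lambda>t. v t \<bullet> e1" "- J"]
      der[of _ e1, folded X_def] der[of _ e2, folded Y_def] big by (auto simp: add.commute)
  have nz: "eventually (\<lambda>t. ?\<rho> t \<noteq> 0) (at_left b)"
    using order_tendstoD(1)[OF \<rho> R_pos] by (auto elim: eventually_mono)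
  have XY: "(X \<longlongrightarrow> l1 * R) (at_left b)" "(Y \<longlongrightarrow> l2 * R) (at_left b)"
    by (rule Lim_transform_eventually[OF tendsto_mult[OF l1 \<rho>]],
        use nz in \<open>auto elim: eventually_mono\<close>)
       (rule Lim_transform_eventually[OF tendsto_mult[OF l2 \<rho>]],
        use nz in \<open>auto elim: eventually_mono\<close>)
  define x where "x = c + (l1 * R) *\<^sub>R e1 + (l2 * R) *\<^sub>R e2"
  have "((\<lambda>t. c + X t *\<^sub>R e1 + Y t *\<^sub>R e2) \<longlongrightarrow> x) (at_left b)"
    unfolding x_def by (intro tendsto_intros XY)
  moreover have "((\<lambda>t. r t - (c + X t *\<^sub>R e1 + Y t *\<^sub>R e2)) \<longlongrightarrow> 0) (at_left b)"
    by (rule Lim_null_comparison[OF _ coll]) (use near(2) in auto)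
  ultimately have lim: "(r \<longlongrightarrow> x) (at_left b)"
    by (rule Lim_transform)
  have "infdist x \<C> = 0"
    by (rule tendsto_unique[OF _ tendsto_infdist[OF lim] coll]) simp
  then have "x \<in> \<C>" using notin_circle_iff[of x] by auto
  with lim show ?thesis by blast
qed

lemma right_end_collision:
  assumes max: "maximal_newton_solution \<C> V a (ereal b) r"
  shows "\<exists>x\<in>\<C>. (r \<longlongrightarrow> x) (at_left b)"
proof -
  have ab: "a < ereal b" and "newton_solution_on \<C> V (einterval a b) r"
    using max by (auto simp: maximal_newton_solution_def)
  then obtain v where v: "motion_on (einterval a b) r v"
    using newton_solution_on_iff_motion_on by blast
  obtain t0 where "t0 \<in> einterval a b" using einterval_nonempty[OF ab] by blast
  then have t0: "a < ereal t0" "t0 < b" by (auto simp: einterval_iff)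
  have a_less: "a < ereal t" if "t0 < t" for t
    using less_trans[OF t0(1), of "ereal t"] that by simp
  then have "{t0<..<b} \<subseteq> einterval a b" by (auto simp: einterval_iff)
  with v have mot: "motion_on {t0<..<b} r v" by (auto simp: motion_on_def)
  show ?thesis
  proof (cases "((\<lambda>t. infdist (r t) \<C>) \<longlongrightarrow> 0) (at_left b)")
    case True
    then show ?thesis by (rule collision_if_distance_tendsto_zero[OF mot t0(2)])
  next
    case False
    obtain t1 \<tau> q w where t1: "t1 < b" and \<tau>: "\<tau> > 0" and q: "\<And>t. t < b \<Longrightarrow> q t = r t"
      and w: "motion_on {t1<..<b+\<tau>} q w"
      using continuation_off_circle[OF mot t0(2) False] by blast
    have "newton_solution_on \<C> V (einterval a (ereal (b + \<tau>))) q"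
      unfolding newton_solution_on_iff_motion_on motion_on_def
    proof (intro exI[of _ "\<lambda>t. if t < b then v t else w t"] ballI)
      fix t assume t: "t \<in> einterval a (ereal (b + \<tau>))"
      \<comment> \<open>The glued velocity coincides with \<open>w\<close> just to the left of \<open>b\<close>, so it is differentiable at \<open>b\<close>.\<close>
      have wv: "w s = v s" if s: "s \<in> {t1<..<b}" "s \<in> einterval a b" for s
      proof -
        have "(q has_vector_derivative w s) (at s)" using motion_onD(2)[OF w] s \<tau> by auto
        moreover have "(q has_vector_derivative v s) (at s)"
          by (rule has_vector_derivative_transform_within_open[OF motion_onD(2)[OF v s(2)], of "{..<b}"])
             (use s q in auto)
        ultimately show ?thesis by (rule vector_derivative_unique_at)
      qed
      show "q t \<notin> \<C> \<and> (q has_vector_derivative (if t < b then v t else w t)) (at t) \<and>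
        ((\<lambda>t. if t < b then v t else w t) has_vector_derivative - gradV (q t)) (at t)"
      proof (cases "t < b")
        case True
        then have tI: "t \<in> einterval a b" using t by (auto simp: einterval_iff)
        note tr = has_vector_derivative_transform_within_open[where S = "{..<b}"]
        show ?thesis
          using motion_onD[OF v tI] True q
          by (auto intro: tr[of r] tr[of v])
      next
        case False
        then have tI: "t \<in> {t1<..<b+\<tau>}" using t t1 by (auto simp: einterval_iff)
        have "t \<in> {max t0 t1<..<b+\<tau>}" using False tI t0 by auto
        then have "((\<lambda>t. if t < b then v t else w t) has_vector_derivative - gradV (q t)) (at t)"
          by (rule has_vector_derivative_transform_within_open[OF motion_onD(3)[OF w tI], rotated])
             (use wv a_less in \<open>auto simp: einterval_iff\<close>)
        then show ?thesis using motion_onD[OF w tI] False by auto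
      qed
    qed
    moreover have "\<forall>t\<in>einterval a b. q t = r t" using q by (auto simp: einterval_iff)
    moreover have "a \<le> a" "ereal b \<le> ereal (b + \<tau>)" using \<tau> by simp_all
    ultimately have "ereal (b + \<tau>) = ereal b"
      using max unfolding maximal_newton_solution_def by blast
    then show ?thesis using \<tau> by simp
  qed
qed

end

section \<open>Time reversal\<close>

text \<open>
  Forces that depend on the position alone are invariant under time reversal, so the left end of a
  maximal interval reduces to the right end.
\<close>

lemma newton_solution_on_time_reversal:
  assumes "newton_solution_on C V I r"
  shows "newton_solution_on C V (uminus ` I) (\<lambda>t. r (- t))"
proof -
  obtain v where off: "\<forall>t\<in>I. r t \<notin> C"
    and v: "\<forall>t\<in>I. (r has_vector_derivative v t) (at t) \<and>
        (\<exists>g. GDERIV V (r t) :> g \<and> (v has_vector_derivative - g) (at t))"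
    using assms by (auto simp: newton_solution_on_def)
  have rev: "((\<lambda>t. f (- t)) has_vector_derivative - f') (at s)"
    if "(f has_vector_derivative f') (at (- s))" for f :: "real \<Rightarrow> real^3" and f' s
  proof -
    have "(uminus has_vector_derivative - 1) (at s)" by (auto intro!: derivative_eq_intros)
    from vector_diff_chain_at[OF this that] show ?thesis by (simp add: o_def)
  qed
  have "((\<lambda>t. r (- t)) has_vector_derivative - v (- t)) (at t) \<and>
      (\<exists>g. GDERIV V (r (- t)) :> g \<and> ((\<lambda>t. - v (- t)) has_vector_derivative - g) (at t))"
    if "t \<in> uminus ` I" for t
  proof -
    have tI: "- t \<in> I" using that by auto
    with v obtain g where r: "(r has_vector_derivative v (- t)) (at (- t))"
      and g: "GDERIV V (r (- t)) :> g" and v': "(v has_vector_derivative - g) (at (- t))"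
      by blast
    have "((\<lambda>t. - v (- t)) has_vector_derivative - (- (- g))) (at t)"
      by (intro has_vector_derivative_minus rev v')
    with rev[OF r] g show ?thesis by auto
  qed
  then show ?thesis using off unfolding newton_solution_on_def by (intro conjI exI[of _ "\<lambda>t. - v (- t)"]) auto
qed

lemma uminus_einterval: "uminus ` einterval a b = einterval (- b) (- a)"
proof -
  have "x \<in> uminus ` einterval a b \<longleftrightarrow> - x \<in> einterval a b" for x
    by force
  also have "\<dots> x \<longleftrightarrow> x \<in> einterval (- b) (- a)" for x
    by (cases a; cases b) (auto simp: einterval_iff)
  finally show ?thesis by blast
qed

lemma maximal_newton_solution_time_reversal:
  assumes "maximal_newton_solution C V a b r"
  shows "maximal_newton_solution C V (- b) (- a) (\<lambda>t. r (- t))"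
proof -
  have ab: "a < b" and sol: "newton_solution_on C V (einterval a b) r"
    and max: "\<And>a' b' q. a' \<le> a \<Longrightarrow> b \<le> b' \<Longrightarrow> newton_solution_on C V (einterval a' b') q \<Longrightarrow>
        (\<forall>t\<in>einterval a b. q t = r t) \<Longrightarrow> a' = a \<and> b' = b"
    using assms unfolding maximal_newton_solution_def by blast+
  show ?thesis
    unfolding maximal_newton_solution_def
  proof (intro conjI allI impI)
    show "- b < - a" using ab by simp
    show "newton_solution_on C V (einterval (- b) (- a)) (\<lambda>t. r (- t))"
      using newton_solution_on_time_reversal[OF sol] by (simp add: uminus_einterval)
    fix a' b' q
    assume q: "a' \<le> - b \<and> - a \<le> b' \<and> newton_solution_on C V (einterval a' b') q \<and>
        (\<forall>t\<in>einterval (- b) (- a). q t = r (- t))"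
    have "- b' = a \<and> - a' = b"
    proof (rule max)
      show "- b' \<le> a" "b \<le> - a'" using q ereal_minus_le_minus[of "- a'" b] by (auto simp: ereal_uminus_le_reorder)
      show "newton_solution_on C V (einterval (- b') (- a')) (\<lambda>t. q (- t))"
        using newton_solution_on_time_reversal[of C V "einterval a' b'" q] q by (simp add: uminus_einterval)
      have "- t \<in> einterval (- b) (- a)" if "t \<in> einterval a b" for t
        using that uminus_einterval[of a b] by blast
      then show "\<forall>t\<in>einterval a b. q (- t) = r t" using q by fastforce
    qed
    then show "a' = - b" "b' = - a" by auto
  qed
qed

section \<open>All singularities are collisions\<close>

theorem theoremA:
  fixes c e1 e2 :: "real^3" and R lam :: real
    and a b :: ereal and r :: "real \<Rightarrow> real^3"
  assumes "R > 0" and "lam > 0"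
    and "norm e1 = 1" and "norm e2 = 1" and "e1 \<bullet> e2 = 0"
    and "maximal_newton_solution (round_circle c R e1 e2) (circle_potential c R e1 e2 lam) a b r"
  shows "(b < \<infinity> \<longrightarrow>
            (\<exists>x\<in>round_circle c R e1 e2. (r \<longlongrightarrow> x) (at_left (real_of_ereal b)))) \<and>
         (a > -\<infinity> \<longrightarrow>
            (\<exists>x\<in>round_circle c R e1 e2. (r \<longlongrightarrow> x) (at_right (real_of_ereal a))))"
proof (intro conjI impI)
  interpret homogeneous_circle c e1 e2 R lam
    using assms by unfold_locales
  have ab: "a < b" using assms(6) by (simp add: maximal_newton_solution_def)
  show "\<exists>x\<in>round_circle c R e1 e2. (r \<longlongrightarrow> x) (at_left (real_of_ereal b))" if fin: "b < \<infinity>"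
  proof -
    obtain b' where b': "b = ereal b'" using fin ab by (cases b) auto
    show ?thesis using right_end_collision[OF assms(6)[unfolded b']] by (simp add: b')
  qed
  show "\<exists>x\<in>round_circle c R e1 e2. (r \<longlongrightarrow> x) (at_right (real_of_ereal a))" if fin: "a > - \<infinity>"
  proof -
    obtain a' where a': "a = ereal a'" using fin ab by (cases a) auto
    have "maximal_newton_solution \<C> V (- b) (ereal (- a')) (\<lambda>t. r (- t))"
      using maximal_newton_solution_time_reversal[OF assms(6)] by (simp add: a')
    from right_end_collision[OF this] show ?thesis
      by (simp add: a' at_right_minus[of a'] filterlim_filtermap)
  qed
qed

end
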